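(* Let $\mu\in\mathbb{C}$ and let $z\in\mathbb{C}$, where, if $\mu\notin\mathbb{Z}$, $z$ is restricted to the complex plane slit along the negative real axis, i.e. $z\in\mathbb{C}\setminus(-\infty,0]$. Then the Bessel function of the first kind $J_\mu$ satisfies $$J_{\mu}(z) = \frac{1}{2\pi}\left(\frac{z}{2}\right)^{\mu}\int_{-\pi}^{\pi} e^{\mathrm{i} z\cos\theta}\,\gamma^*\!\left(\mu,\tfrac{1}{2}\mathrm{i} z e^{\mathrm{i}\theta}\right)\mathrm{d}\theta ,$$ where $\gamma^*$ is Tricomi's (entire) incomplete gamma function.
   Context: Tricomi's incomplete gamma function $\gamma^*(\mu,w)$ is the function, entire in both $\mu\in\mathbb{C}$ and $w\in\mathbb{C}$, given for $\mathrm{Re}\,\mu>0$ (and $w\neq 0$) by $$\gamma^*(\mu,w)=\frac{w^{-\mu}}{\Gamma(\mu)}\int_0^w e^{-t}t^{\mu-1}\,\mathrm{d}t=\frac{1}{\Gamma(\mu)}\int_0^1 e^{-ws}s^{\mu-1}\,\mathrm{d}s,$$ and for all $\mu,w\in\mathbb{C}$ by $\gamma^*(\mu,w)=\frac{e^{-w}}{\Gamma(1+\mu)}M(1,1+\mu;w)$ with $M$ the Kummer confluent hypergeometric function, i.e. $\gamma^*(\mu,w)=e^{-w}\sum_{k=0}^\infty \frac{w^k}{\Gamma(\mu+k+1)}$, with the convention that $1/\Gamma$ vanishes at the non-positive integers. The Bessel function of the first kind is $J_\mu(z)=\left(\frac z2\right)^\mu\sum_{k=0}^\infty\frac{(-1)^k}{k!\,\Gamma(\mu+k+1)}\left(\frac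 z2\right)^{2k}$. For $\mu\notin\mathbb{Z}$ the power $(z/2)^\mu$ is the principal branch on $\mathbb{C}\setminus(-\infty,0]$; for $\mu\in\mathbb{Z}$ it is the ordinary integer power. In the exceptional case where $\mu$ is a negative integer and $z=0$, both $J_\mu(z)$ and the right-hand side are understood as the limits as $z\to0$. *)

theory Defs
  imports "HOL-Analysis.Analysis"
begin

text \<open>
  Ordinary integer power for integer exponents (so \<open>cpower 0 0 = 1\<close>, unlike \<open>powr\<close>),
  principal branch otherwise.
\<close>

definition cpower :: "complex \<Rightarrow> complex \<Rightarrow> complex" where
  "cpower w \<mu> = (if \<mu> \<in> \<int> then w powi \<lfloor>Re \<mu>\<rfloor> else w powr \<mu>)"

text \<open>
  Tricomi's incomplete gamma function \<open>\<gamma>\<^sup>*(\<mu>, w) = e\<^sup>-\<^sup>w M(1, 1 + \<mu>; w) / \<Gamma>(1 + \<mu>)\<close>,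
  with the Kummer series written out; \<open>rGamma\<close> is the entire function \<open>1/\<Gamma>\<close>.
\<close>

definition tricomi_gamma :: "complex \<Rightarrow> complex \<Rightarrow> complex" where
  "tricomi_gamma \<mu> w = exp (- w) * (\<Sum>k. w ^ k * rGamma (\<mu> + of_nat k + 1))"

definition bessel_series :: "complex \<Rightarrow> complex \<Rightarrow> complex" where
  "bessel_series \<mu> z = cpower (z / 2) \<mu> *
     (\<Sum>k. (-1) ^ k * rGamma (\<mu> + of_nat k + 1) / fact k * (z / 2) ^ (2 * k))"

text \<open>
  At \<open>z = 0\<close> the series formula is meaningless for negative integers \<open>\<mu>\<close>
  (\<open>powi\<close> would silently give \<open>0\<close>); there the value is the limit.
\<close>

definition besselJ :: "complex \<Rightarrow> complex \<Rightarrow> complex" where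
  "besselJ \<mu> z =
     (if \<mu> \<in> \<int> \<and> Re \<mu> < 0 \<and> z = 0 then Lim (at 0) (bessel_series \<mu>) else bessel_series \<mu> z)"

end

theory Submission imports Defs begin

text \<open>
  With \<open>a = \<i> z / 2\<close> the integrand is
  \<open>exp (a e\<^sup>-\<^sup>i\<^sup>\<theta>) \<Sum>\<^sub>k rGamma (\<mu> + k + 1) a\<^sup>k e\<^sup>i\<^sup>k\<^sup>\<theta>\<close>, because
  \<open>\<i> z cos \<theta> = a e\<^sup>i\<^sup>\<theta> + a e\<^sup>-\<^sup>i\<^sup>\<theta>\<close> and the first summand cancels the exponential
  factor of Tricomi's function. Both series converge uniformly in \<open>\<theta>\<close>, and orthogonality
  of the exponentials leaves the diagonal terms \<open>2 \<pi> rGamma (\<mu> + k + 1) a\<^sup>2\<^sup>k / k!\<close>.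
\<close>

section \<open>Termwise integration and majorants\<close>

lemma sums_integral_Weierstrass:
  fixes f :: "nat \<Rightarrow> real \<Rightarrow> complex"
  assumes cont: "\<And>k. continuous_on {a..b} (f k)"
    and bound: "\<And>k t. t \<in> {a..b} \<Longrightarrow> norm (f k t) \<le> M k"
    and "summable M"
  shows "(\<lambda>k. integral {a..b} (f k)) sums integral {a..b} (\<lambda>t. \<Sum>k. f k t)"
proof -
  have ul: "uniform_limit {a..b} (\<lambda>n t. \<Sum>k<n. f k t) (\<lambda>t. \<Sum>k. f k t) sequentially"
    using bound \<open>summable M\<close> by (rule Weierstrass_m_test)
  have "continuous_on {a..b} (\<lambda>t. \<Sum>k<n. f k t)" for n
    by (intro continuous_on_sum cont)
  then obtain I J where I: "\<And>n. ((\<lambda>t. \<Sum>k<n. f k t) has_integral I n) {a..b}"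
    and J: "((\<lambda>t. \<Sum>k. f k t) has_integral J) {a..b}" and lim: "I \<longlonglongrightarrow> J"
    using uniform_limit_integral[OF ul] by auto
  have I_eq: "I = (\<lambda>n. \<Sum>k<n. integral {a..b} (f k))"
  proof
    fix n
    have "((\<lambda>t. \<Sum>k<n. f k t) has_integral (\<Sum>k<n. integral {a..b} (f k))) {a..b}"
      by (intro has_integral_sum integrable_integral integrable_continuous_real cont) auto
    with I show "I n = (\<Sum>k<n. integral {a..b} (f k))" by (rule has_integral_unique)
  qed
  from lim show ?thesis
    unfolding sums_def I_eq integral_unique[OF J] .
qed

text \<open>The recurrence of \<open>rGamma\<close> makes the quotient of consecutive terms
  \<open>r / norm (\<mu> + of_nat n + 1)\<close>, which tends to 0. The series dominates both the
  Tricomi series and the Bessel coefficients below.\<close>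

lemma summable_norm_rGamma_power:
  fixes \<mu> :: complex and r :: real
  shows "summable (\<lambda>k. norm (rGamma (\<mu> + of_nat k + 1)) * r ^ k)"
proof -
  \<comment> \<open>For \<open>n \<ge> N\<close> this gives \<open>norm (\<mu> + of_nat n + 1) \<ge>
    n + 1 - norm \<mu> \<ge> 2 * \<bar>r\<bar>\<close>, which is what the ratio 1/2 asks
    for.\<close>
  obtain N :: nat where N: "real N \<ge> norm \<mu> + 2 * \<bar>r\<bar> + 1"
    using real_arch_simple by blast
  show ?thesis
  proof (rule summable_ratio_test[where c = "1/2" and N = N])
    fix n assume "n \<ge> N"
    define w where "w = \<mu> + of_nat n + 1"
    have "norm (of_nat (Suc n) :: complex) \<le> norm w + norm \<mu>"
      using norm_triangle_ineq4[of w \<mu>] by (simp add: w_def algebra_simps)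
    moreover have "norm (of_nat (Suc n) :: complex) = real (Suc n)"
      by (rule norm_of_nat)
    ultimately have "real n + 1 \<le> norm w + norm \<mu>"
      by simp
    with N \<open>n \<ge> N\<close> have w: "2 * \<bar>r\<bar> + 1 \<le> norm w"
      by linarith
    have "rGamma w = w * rGamma (w + 1)"
      by (simp add: rGamma_plus1)
    then have "norm (rGamma w) \<ge> (2 * \<bar>r\<bar>) * norm (rGamma (w + 1))"
      using w by (auto simp: norm_mult intro!: mult_right_mono)
    then have "\<bar>r\<bar> * norm (rGamma (w + 1)) * \<bar>r\<bar> ^ n \<le> (1/2 * norm (rGamma w)) * \<bar>r\<bar> ^ n"
      by (intro mult_right_mono) auto
    moreover have Suc: "\<mu> + of_nat (Suc n) + 1 = w + 1"
      by (simp add: w_def)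
    ultimately show "norm (norm (rGamma (\<mu> + of_nat (Suc n) + 1)) * r ^ Suc n)
        \<le> 1/2 * norm (norm (rGamma (\<mu> + of_nat n + 1)) * r ^ n)"
      unfolding Suc w_def[symmetric] by (simp add: abs_mult power_abs mult_ac)
  qed simp
qed

section \<open>Fourier integrals\<close>

lemma integral_exp_int:
  fixes m :: int
  shows "integral {-pi..pi} (\<lambda>t. exp (\<i> * of_int m * of_real t)) = (if m = 0 then 2 * of_real pi else 0)"
proof (cases "m = 0")
  case False
  define F where "F = (\<lambda>t::real. exp (\<i> * of_int m * of_real t) / (\<i> * of_int m))"
  have "((\<lambda>t. exp (\<i> * of_int m * of_real t)) has_integral F pi - F (-pi)) {-pi..pi}"
  proof (rule fundamental_theorem_of_calculus)
    fix t :: real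
    have "((\<lambda>w. exp (\<i> * of_int m * w) / (\<i> * of_int m)) has_field_derivative
            exp (\<i> * of_int m * of_real t)) (at (of_real t))"
      using False by (auto intro!: derivative_eq_intros)
    then show "(F has_vector_derivative exp (\<i> * of_int m * of_real t)) (at t within {-pi..pi})"
      unfolding F_def using has_vector_derivative_real_field by blast
  qed simp
  \<comment> \<open>The two exponents differ by \<open>m\<close> full periods of \<open>exp\<close>,
    so the antiderivative takes the same value at both endpoints.\<close>
  moreover have "exp (\<i> * of_int m * of_real pi) = exp (\<i> * of_int m * of_real (-pi))"
    by (subst exp_eq) (auto intro!: exI[of _ m] simp: algebra_simps)
  ultimately show ?thesis
    using False by (simp add: F_def integral_unique)
qed (simp add: scaleR_conv_of_real)

text \<open>Expanding the outer exponential produces the frequencies \<open>k - n\<close> with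
  weights \<open>a ^ n / fact n\<close>; by orthogonality only \<open>n = k\<close>
  survives.\<close>

lemma integral_exp_fourier_coeff:
  fixes a :: complex and k :: nat
  shows "integral {-pi..pi} (\<lambda>t. exp (\<i> * of_nat k * of_real t) * exp (a * exp (- \<i> * of_real t)))
           = 2 * of_real pi * a ^ k / fact k"
proof -
  define f where "f = (\<lambda>n t. a ^ n / fact n * exp (\<i> * of_int (int k - int n) * of_real t))"
  have "(\<lambda>n. f n t) sums (exp (\<i> * of_nat k * of_real t) * exp (a * exp (- \<i> * of_real t)))" for t
  proof -
    have "exp (\<i> * of_nat k * of_real t) * ((a * exp (- \<i> * of_real t)) ^ n /\<^sub>R fact n) = f n t" for n
    proof -
      \<comment> \<open>Splitting the frequency into \<open>k\<close> and \<open>- n\<close> lets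
        the second part become the \<open>n\<close>-th power of
        \<open>exp (- \<i> * of_real t)\<close>.\<close>
      have "f n t = a ^ n / fact n * exp (\<i> * of_nat k * of_real t + of_nat n * (- \<i> * of_real t))"
        by (simp add: f_def algebra_simps)
      then show ?thesis
        unfolding exp_add exp_of_nat_mult
        by (simp add: power_mult_distrib scaleR_conv_of_real field_simps)
    qed
    with sums_mult[OF exp_converges, of "exp (\<i> * of_nat k * of_real t)" "a * exp (- \<i> * of_real t)"]
    show ?thesis by simp
  qed
  then have f_sum: "(\<Sum>n. f n t) = exp (\<i> * of_nat k * of_real t) * exp (a * exp (- \<i> * of_real t))" for t
    by (rule sums_unique[symmetric])
  \<comment> \<open>The difference \<open>int k - int n\<close> stays a single integer, so that
    \<open>integral_exp_int\<close> applies to it.\<close>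
  have int_f: "integral {-pi..pi} (f n) = (if n = k then 2 * of_real pi * a ^ k / fact k else 0)" for n
    unfolding f_def by (simp add: integral_exp_int del: of_int_diff)
  have "(\<lambda>n. integral {-pi..pi} (f n)) sums integral {-pi..pi} (\<lambda>t. \<Sum>n. f n t)"
  proof (rule sums_integral_Weierstrass)
    show "summable (\<lambda>n. norm a ^ n / fact n)"
      using summable_exp[of "norm a"] by (simp add: divide_inverse mult.commute)
    show "continuous_on {-pi..pi} (f n)" for n
      unfolding f_def by (intro continuous_intros)
    show "norm (f n t) \<le> norm a ^ n / fact n" for n t
      by (simp add: f_def norm_mult norm_divide norm_power)
  qed
  then have "(\<lambda>n. if n = k then 2 * of_real pi * a ^ k / fact k else 0) sums
      integral {-pi..pi} (\<lambda>t. \<Sum>n. f n t)"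
    unfolding int_f .
  moreover have "(\<lambda>n. if n = k then 2 * of_real pi * a ^ k / fact k else 0 :: complex) sums
      (2 * of_real pi * a ^ k / fact k)"
    by (rule sums_single)
  ultimately show ?thesis
    unfolding f_sum by (rule sums_unique2)
qed

section \<open>Evaluation of the integral\<close>

text \<open>Only the Tricomi series is expanded here; the factor
  \<open>exp (a * exp (- \<i> * of_real t))\<close> stays closed, so each term is a multiple of a
  Fourier coefficient already computed and no double series arises.\<close>

lemma tricomi_gamma_integral:
  fixes \<mu> z :: complex
  shows "integral {-pi..pi} (\<lambda>\<theta>. exp (\<i> * z * cos (of_real \<theta>)) *
           tricomi_gamma \<mu> (1 / 2 * \<i> * z * exp (\<i> * of_real \<theta>)))
         = 2 * of_real pi *
             (\<Sum>k. (-1) ^ k * rGamma (\<mu> + of_nat k + 1) / fact k * (z / 2) ^ (2 * k))"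
proof -
  define a where "a = \<i> * z / 2"
  define c where "c = (\<lambda>k. rGamma (\<mu> + of_nat k + 1))"
  define f where "f = (\<lambda>k t. c k * a ^ k *
    (exp (\<i> * of_nat k * of_real t) * exp (a * exp (- \<i> * of_real t))))"
  have integrand: "exp (\<i> * z * cos (of_real t)) * tricomi_gamma \<mu> (1 / 2 * \<i> * z * exp (\<i> * of_real t))
      = (\<Sum>k. f k t)" for t
  proof -
    define w where "w = a * exp (\<i> * of_real t)"
    \<comment> \<open>Euler's formula for the cosine; the summand \<open>w\<close> is the one that
      the factor \<open>exp (- w)\<close> of Tricomi's function cancels.\<close>
    have "\<i> * z * cos (of_real t) = w + a * exp (- \<i> * of_real t)"
      by (simp add: w_def a_def cos_exp_eq algebra_simps)
    then have "exp (\<i> * z * cos (of_real t)) * exp (- w) = exp (a * exp (- \<i> * of_real t))"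
      by (simp flip: exp_add)
    moreover have "tricomi_gamma \<mu> (1 / 2 * \<i> * z * exp (\<i> * of_real t)) = exp (- w) * (\<Sum>k. w ^ k * c k)"
      by (simp add: tricomi_gamma_def w_def a_def c_def)
    ultimately have "exp (\<i> * z * cos (of_real t)) * tricomi_gamma \<mu> (1 / 2 * \<i> * z * exp (\<i> * of_real t))
        = exp (a * exp (- \<i> * of_real t)) * (\<Sum>k. w ^ k * c k)"
      by (metis mult.assoc)
    also have "\<dots> = (\<Sum>k. exp (a * exp (- \<i> * of_real t)) * (w ^ k * c k))"
    proof (rule suminf_mult[symmetric], rule summable_norm_cancel)
      show "summable (\<lambda>k. norm (w ^ k * c k))"
        using summable_norm_rGamma_power[of \<mu> "norm w"]
        by (simp add: c_def norm_mult norm_power mult.commute)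
    qed
    also have "\<dots> = (\<Sum>k. f k t)"
      by (simp add: f_def w_def power_mult_distrib mult_ac flip: exp_of_nat_mult)
    finally show ?thesis .
  qed
  have "(\<lambda>k. integral {-pi..pi} (f k)) sums integral {-pi..pi} (\<lambda>t. \<Sum>k. f k t)"
  proof (rule sums_integral_Weierstrass)
    \<comment> \<open>The majorant is uniform in \<open>t\<close>:
      \<open>exp (\<i> * of_nat k * of_real t)\<close> has modulus 1, and the remaining exponential
      is at most \<open>exp (norm a)\<close>.\<close>
    show "summable (\<lambda>k. norm (c k) * norm a ^ k * exp (norm a))"
      unfolding c_def by (intro summable_mult2 summable_norm_rGamma_power)
    show "continuous_on {-pi..pi} (f k)" for k
      unfolding f_def by (intro continuous_intros)
    show "norm (f k t) \<le> norm (c k) * norm a ^ k * exp (norm a)" for k t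
    proof -
      have "norm (exp (a * exp (- \<i> * of_real t))) \<le> exp (norm (a * exp (- \<i> * of_real t)))"
        by (rule norm_exp)
      then have "norm (exp (a * exp (- \<i> * of_real t))) \<le> exp (norm a)"
        by (simp add: norm_mult)
      then show ?thesis
        by (auto simp: f_def norm_mult norm_power intro!: mult_left_mono)
    qed
  qed
  moreover have "integral {-pi..pi} (f k) =
      2 * of_real pi * ((-1) ^ k * c k / fact k * (z / 2) ^ (2 * k))" for k
  proof -
    \<comment> \<open>One factor \<open>a ^ k\<close> comes from the Tricomi series, the other from
      the Fourier coefficient. Their product yields the alternating sign, since \<open>\<i>\<close>
      squares to -1.\<close>
    have "a ^ k * a ^ k = (a ^ 2) ^ k"
      by (simp add: power2_eq_square power_mult_distrib)
    also have "a ^ 2 = (-1) * (z / 2) ^ 2"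
      by (simp add: a_def power_divide power_mult_distrib)
    finally have "a ^ k * a ^ k = (-1) ^ k * (z / 2) ^ (2 * k)"
      by (simp only: power_mult_distrib power_mult)
    then show ?thesis
      unfolding f_def integral_mult_right integral_exp_fourier_coeff
      by (simp add: field_simps)
  qed
  ultimately have *: "(\<lambda>k. 2 * of_real pi * ((-1) ^ k * c k / fact k * (z / 2) ^ (2 * k))) sums
      integral {-pi..pi} (\<lambda>t. \<Sum>k. f k t)"
    by simp
  \<comment> \<open>Convergence of the Bessel series is inherited from the integrated series on
    dividing by the nonzero constant \<open>2 * of_real pi\<close>.\<close>
  have "summable (\<lambda>k. (-1) ^ k * c k / fact k * (z / 2) ^ (2 * k))"
    using summable_mult_D[OF sums_summable[OF *]] by simp
  then show ?thesis
    unfolding integrand using sums_unique2[OF * sums_mult[OF summable_sums]] by (simp add: c_def)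
qed

section \<open>The Bessel series and its limit at the origin\<close>

text \<open>Both sides carry the same factor \<open>cpower (z / 2) \<mu>\<close>. They agree even at
  \<open>z = 0\<close> with a negative integer \<open>\<mu>\<close>, where \<open>powi\<close> makes
  both 0, so limits at 0 pass from one side to the other.\<close>

corollary bessel_series_eq_integral:
  "bessel_series \<mu> z = 1 / (2 * of_real pi) * cpower (z / 2) \<mu> *
     integral {-pi..pi} (\<lambda>\<theta>. exp (\<i> * z * cos (of_real \<theta>)) *
       tricomi_gamma \<mu> (1 / 2 * \<i> * z * exp (\<i> * of_real \<theta>)))"
  unfolding tricomi_gamma_integral bessel_series_def by simp

text \<open>
  The coefficients with \<open>k < m\<close> vanish, which leaves a factor \<open>(z / 2)\<^sup>m\<close>.
\<close>

lemma bessel_series_neg_int_tendsto: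
  fixes m :: nat
  assumes "m > 0"
  shows "(bessel_series (- of_nat m) \<longlongrightarrow> 0) (at 0)"
proof -
  define d :: "nat \<Rightarrow> complex" where "d = (\<lambda>k. (-1) ^ k * rGamma (- of_nat m + of_nat k + 1) / fact k)"
  define G where "G = (\<lambda>x. \<Sum>k. d (k + m) * x ^ k)"
  have d_summable: "summable (\<lambda>k. d k * x ^ k)" for x
  proof (rule summable_comparison_test'[OF summable_norm_rGamma_power])
    fix k
    have "norm (rGamma (- of_nat m + of_nat k + 1 :: complex)) / fact k
        \<le> norm (rGamma (- of_nat m + of_nat k + 1 :: complex)) / 1"
      by (intro divide_left_mono) (auto simp: fact_ge_1)
    from mult_right_mono[OF this, of "norm x ^ k"] show "norm (d k * x ^ k) \<le> norm (rGamma (- of_nat m + of_nat k + 1 :: complex)) * norm x ^ k"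
      by (simp add: d_def norm_mult norm_divide norm_power)
  qed
  have d0: "d k = 0" if "k < m" for k
  proof -
    \<comment> \<open>The right-hand side is a non-positive integer exactly because
      \<open>k < m\<close>, hence a pole of the Gamma function.\<close>
    have "- of_nat m + of_nat k + 1 = (- of_nat (m - k - 1) :: complex)"
      using that by (simp add: of_nat_diff)
    then show ?thesis
      by (simp add: d_def rGamma_eq_zero_iff)
  qed
  have tail: "summable (\<lambda>k. d (k + m) * x ^ k)" for x
  \<comment> \<open>For \<open>x \<noteq> 0\<close> the shifted series is a tail of the full one
    divided by \<open>x ^ m\<close>; at 0 only the constant term remains.\<close>
  proof (cases "x = 0")
    case False
    have "summable (\<lambda>k. inverse (x ^ m) * (d (k + m) * x ^ (k + m)))"
      using d_summable[of x] by (intro summable_mult summable_ignore_initial_segment)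
    with False show ?thesis by (simp add: power_add field_simps)
  qed simp
  have eq: "bessel_series (- of_nat m) z = (z / 2) ^ m * G ((z / 2)\<^sup>2)" if "z \<noteq> 0" for z
  proof -
    define x where "x = (z / 2)\<^sup>2"
    have "(\<Sum>k. d k * x ^ k) = (\<Sum>k. d (k + m) * x ^ (k + m)) + (\<Sum>k<m. d k * x ^ k)"
      by (rule suminf_split_initial_segment[OF d_summable])
    also have "(\<Sum>k<m. d k * x ^ k) = 0"
      by (simp add: d0)
    also have "(\<Sum>k. d (k + m) * x ^ (k + m)) = x ^ m * G x"
      unfolding G_def suminf_mult[OF tail, symmetric] by (simp add: power_add mult_ac)
    finally have "(\<Sum>k. d k * x ^ k) = x ^ m * G x" by simp
    \<comment> \<open>The exponents \<open>- m\<close> and \<open>2 * m\<close> of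
      \<open>z / 2\<close> add up to \<open>m\<close>, so the singular factor disappears.\<close>
    moreover have "cpower (z / 2) (- of_nat m) * x ^ m = (z / 2) ^ m"
    proof -
      have "\<lfloor>Re (- of_nat m)\<rfloor> = - int m"
        by (simp add: floor_eq_iff)
      then have "cpower (z / 2) (- of_nat m) = inverse ((z / 2) ^ m)"
        by (simp add: cpower_def power_int_minus)
      moreover have "x ^ m = (z / 2) ^ m * (z / 2) ^ m"
        by (simp only: x_def power2_eq_square power_mult_distrib)
      moreover have "(z / 2) ^ m \<noteq> 0"
        using that by simp
      ultimately show ?thesis
        by (metis left_inverse mult.assoc mult_1)
    qed
    moreover have "bessel_series (- of_nat m) z = cpower (z / 2) (- of_nat m) * (\<Sum>k. d k * x ^ k)"
      unfolding bessel_series_def d_def x_def power_mult ..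
    ultimately show ?thesis
      unfolding x_def by (metis mult.assoc)
  qed
  have "isCont G x" for x
    unfolding G_def by (rule isCont_powser_converges_everywhere[OF tail])
  then have "isCont (\<lambda>z. G ((z / 2)\<^sup>2)) 0"
    by (intro isCont_o2[where f = "\<lambda>z. (z / 2)\<^sup>2" and g = G] continuous_intros) simp_all
  then have "isCont (\<lambda>z. (z / 2) ^ m * G ((z / 2)\<^sup>2)) 0"
    by (intro continuous_intros) simp_all
  \<comment> \<open>Here \<open>m > 0\<close> enters: it makes the value of the continuous function
    at 0 equal to 0.\<close>
  then have "((\<lambda>z. (z / 2) ^ m * G ((z / 2)\<^sup>2)) \<longlongrightarrow> 0) (at 0)"
    using assms by (simp add: isCont_def zero_power)
  then show ?thesis
    by (rule Lim_transform_eventually) (auto simp: eventually_at_filter eq)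
qed

theorem theorem1:
  fixes \<mu> z :: complex
  assumes "\<mu> \<notin> \<int> \<Longrightarrow> z \<notin> \<real>\<^sub>\<le>\<^sub>0"
  shows "(\<not> (\<mu> \<in> \<int> \<and> Re \<mu> < 0 \<and> z = 0) \<longrightarrow>
           besselJ \<mu> z = 1 / (2 * of_real pi) * cpower (z / 2) \<mu> *
             integral {-pi..pi} (\<lambda>\<theta>. exp (\<i> * z * cos (of_real \<theta>)) *
               tricomi_gamma \<mu> (1 / 2 * \<i> * z * exp (\<i> * of_real \<theta>)))) \<and>
         (\<mu> \<in> \<int> \<and> Re \<mu> < 0 \<and> z = 0 \<longrightarrow>
           (besselJ \<mu> \<longlongrightarrow> besselJ \<mu> 0) (at 0) \<and>
           ((\<lambda>w. 1 / (2 * of_real pi) * cpower (w / 2) \<mu> *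
             integral {-pi..pi} (\<lambda>\<theta>. exp (\<i> * w * cos (of_real \<theta>)) *
               tricomi_gamma \<mu> (1 / 2 * \<i> * w * exp (\<i> * of_real \<theta>)))) \<longlongrightarrow> besselJ \<mu> 0) (at 0))"
proof (intro conjI impI)
  assume "\<not> (\<mu> \<in> \<int> \<and> Re \<mu> < 0 \<and> z = 0)"
  then show "besselJ \<mu> z = 1 / (2 * of_real pi) * cpower (z / 2) \<mu> *
      integral {-pi..pi} (\<lambda>\<theta>. exp (\<i> * z * cos (of_real \<theta>)) *
        tricomi_gamma \<mu> (1 / 2 * \<i> * z * exp (\<i> * of_real \<theta>)))"
    unfolding bessel_series_eq_integral[symmetric] by (auto simp: besselJ_def)
next
  assume \<mu>: "\<mu> \<in> \<int> \<and> Re \<mu> < 0 \<and> z = 0"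
  then obtain j where j: "\<mu> = of_int j" "j < 0"
    by (auto elim: Ints_cases)
  \<comment> \<open>In the exceptional case the limit of the series is 0, and both
    \<open>besselJ\<close> and the integral expression inherit it.\<close>
  then have "\<mu> = - of_nat (nat (- j))" "nat (- j) > 0"
    by simp_all
  then have lim: "(bessel_series \<mu> \<longlongrightarrow> 0) (at 0)"
    using bessel_series_neg_int_tendsto by metis
  then have J0: "besselJ \<mu> 0 = 0"
    using \<mu> by (simp add: besselJ_def tendsto_Lim)
  from lim show "(besselJ \<mu> \<longlongrightarrow> besselJ \<mu> 0) (at 0)"
    \<comment> \<open>Away from 0, \<open>besselJ \<mu>\<close> coincides with
      \<open>bessel_series \<mu>\<close>, and the limit only sees the punctured
      neighbourhood.\<close>
    unfolding J0 by (rule Lim_transform_eventually) (auto simp: eventually_at_filter besselJ_def)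
  from lim show "((\<lambda>w. 1 / (2 * of_real pi) * cpower (w / 2) \<mu> *
      integral {-pi..pi} (\<lambda>\<theta>. exp (\<i> * w * cos (of_real \<theta>)) *
        tricomi_gamma \<mu> (1 / 2 * \<i> * w * exp (\<i> * of_real \<theta>)))) \<longlongrightarrow> besselJ \<mu> 0) (at 0)"
    unfolding J0 bessel_series_eq_integral[symmetric] .
qed

end
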